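(* Let $m,n\geq1$ be integers. The SFT $Y_{\mathcal{S}_0}$ on $BS(m,n)$ is non-empty and weakly aperiodic.
   Context: $BS(m,n)=\langle a,b \mid b a^{m} b^{-1} = a^n\rangle$. It acts on configurations $x\in\mathcal{A}^{BS(m,n)}$ ($\mathcal{A}$ finite) by $(g\cdot x)_h=x_{g^{-1}h}$; $x$ is strongly periodic if its orbit is finite. A subshift of finite type (SFT) is the set of all configurations avoiding a finite set of finite patterns (up to translation). An SFT is weakly aperiodic if it is non-empty and contains no strongly periodic configuration. Wang tiles. A Wang tile of $BS(m,n)$ is a tuple $s=(t_1,\dots,t_m,l,r,b_1,\dots,b_n)$ of colors, with $s(\text{top}_k)=t_k$, $s(\text{left})=l$, $s(\text{right})=r$, $s(\text{bottom}_j)=b_j$. For a finite tileset $\tau$, $X^\tau$ is the set of $T\in\tau^{BS(m,n)}$ such that for all $g$, all $1\le k\le m$ and $1\le j\le n$: $T_g(\text{right})=T_{ga^m}(\text{left})$ and $T_g(\text{top}_k)=T_{ga^{k-j}b}(\text{bottom}_j)$. The tilesets $\tau_{q,I}$. The height $\|g\|_b$ of $g$ is the number of $b$'s minus the number of $b^{-1}$'s in any word representing $g$. Define $\alpha$ on words over $\{a,b,a^{-1},b^{-1}\}$ by $\alpha(\epsilon)=0$ for the empty word, $\alpha(wb)=\alpha(wb^{-1})=\alpha(w)$, $\alpha(wa)=\alpha(w)+(n/m)^{\|w\|_b}$, $\alpha(wa^{-1})=\alpha(w)-(n/m)^{\|w\|_b}$; this induces a well-defined map $\alpha:BS(m,n)\to\mathbb{R}$.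 Let $\lambda(g)=\frac1m\left(\frac mn\right)^{\|g\|_b}\alpha(g)$. For $q\in\mathbb{Q}$, $g\in BS(m,n)$, $x\in\mathbb{R}$ put $t_j(g,x)=\lfloor(m\lambda(g)+j)x\rfloor-\lfloor(m\lambda(g)+j-1)x\rfloor$ for $1\le j\le m$, $b_j(g,x)=\lfloor(n\lambda(g)+j)qx\rfloor-\lfloor(n\lambda(g)+j-1)qx\rfloor$ for $1\le j\le n$, $l(g,x)=\frac qm\lfloor m\lambda(g)x\rfloor-\frac1n\lfloor n\lambda(g)qx\rfloor$, $r(g,x)=\frac qm\lfloor(m\lambda(g)+m)x\rfloor-\frac1n\lfloor(n\lambda(g)+n)qx\rfloor$, and let $\tau_{q,I}$ be the set of all tiles $(t_1(g,x),\dots,t_m(g,x),l(g,x),r(g,x),b_1(g,x),\dots,b_n(g,x))$ with $g\in BS(m,n)$, $x\in I$. The SFT $Y_{\mathcal{S}_0}$. It encodes the system $\mathcal{S}_0=\{f_1,f_2\}$, $f_1:[\frac13,1]\to[\frac23,2]$, $x\mapsto2x$, and $f_2:[1,2]\to[\frac13,\frac23]$, $x\mapsto\frac13x$. Let $\tau$ be the (finite) set of tiles $(t_1,\dots,t_m,(l,i),(r,i),b_1,\dots,b_n)$ with $i\in\{1,2\}$ and $(t_1,\dots,t_m,l,r,b_1,\dots,b_n)$ in $\tau_{2,[0,1]}$ if $i=1$, in $\tau_{1/3,[1,2]}$ if $i=2$; such a tile is said to have color $i$. $Y_{\mathcal{S}_0}$ is the set of $T\in X^\tau$ such that, whenever $T_g$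 has color $1$, every $3$ consecutive terms of the sequence $(T_{ga^{j}}(\text{top}_1))_{j\in\mathbb{Z}}$ of labels on the upper side of the line of $g$ contain at least one label $1$. *)

theory Defs
  imports Complex_Main "HOL-Algebra.Group_Action"
begin

section \<open>Baumslag-Solitar groups\<close>

datatype letter = L_a | L_b | L_a_inv | L_b_inv

text \<open>
  The congruence on words generated by free cancellation and the defining relation
  \<open>b a\<^sup>m b\<^sup>-\<^sup>1 = a\<^sup>n\<close>; the group is the quotient of the words by it.
\<close>
inductive bs_eq :: "nat \<Rightarrow> nat \<Rightarrow> letter list \<Rightarrow> letter list \<Rightarrow> bool" for m n :: nat where
  rel: "bs_eq m n (L_b # replicate m L_a @ [L_b_inv]) (replicate n L_a)"
| a_a_inv: "bs_eq m n [L_a, L_a_inv] []"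
| a_inv_a: "bs_eq m n [L_a_inv, L_a] []"
| b_b_inv: "bs_eq m n [L_b, L_b_inv] []"
| b_inv_b: "bs_eq m n [L_b_inv, L_b] []"
| refl: "bs_eq m n u u"
| sym: "bs_eq m n u v \<Longrightarrow> bs_eq m n v u"
| trans: "bs_eq m n u v \<Longrightarrow> bs_eq m n v w \<Longrightarrow> bs_eq m n u w"
| cong: "bs_eq m n u u' \<Longrightarrow> bs_eq m n v v' \<Longrightarrow> bs_eq m n (u @ v) (u' @ v')"

definition bs_class :: "nat \<Rightarrow> nat \<Rightarrow> letter list \<Rightarrow> letter list set" where
  "bs_class m n w = {v. bs_eq m n w v}"

definition BS :: "nat \<Rightarrow> nat \<Rightarrow> letter list set monoid" where
  "BS m n =
    \<lparr>carrier = range (bs_class m n),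
     mult = (\<lambda>X Y. {w. \<exists>u\<in>X. \<exists>v\<in>Y. bs_eq m n (u @ v) w}),
     one = bs_class m n []\<rparr>"

abbreviation bs_a :: "nat \<Rightarrow> nat \<Rightarrow> letter list set" where
  "bs_a m n \<equiv> bs_class m n [L_a]"

abbreviation bs_b :: "nat \<Rightarrow> nat \<Rightarrow> letter list set" where
  "bs_b m n \<equiv> bs_class m n [L_b]"

lemma bs_class_eq_iff: "bs_class m n u = bs_class m n v \<longleftrightarrow> bs_eq m n u v"
  unfolding bs_class_def by (blast intro: bs_eq.refl bs_eq.sym bs_eq.trans)

lemma carrier_BS: "carrier (BS m n) = range (bs_class m n)"
  by (simp add: BS_def)

lemma one_BS: "\<one>\<^bsub>BS m n\<^esub> = bs_class m n []"
  by (simp add: BS_def)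

lemma mult_BS: "bs_class m n u \<otimes>\<^bsub>BS m n\<^esub> bs_class m n v = bs_class m n (u @ v)"
  by (auto simp: BS_def bs_class_def intro: bs_eq.trans bs_eq.cong bs_eq.refl)

primrec letter_inv :: "letter \<Rightarrow> letter" where
  "letter_inv L_a = L_a_inv"
| "letter_inv L_b = L_b_inv"
| "letter_inv L_a_inv = L_a"
| "letter_inv L_b_inv = L_b"

lemma bs_eq_letter_inv: "bs_eq m n [letter_inv x, x] []"
  by (cases x) (auto intro: bs_eq.intros)

lemma bs_eq_word_inv: "bs_eq m n (rev (map letter_inv w) @ w) []"
proof (induction w)
  case Nil
  show ?case by (simp add: bs_eq.refl)
next
  case (Cons x w)
  let ?i = "rev (map letter_inv w)"
  have "bs_eq m n (?i @ ([letter_inv x, x] @ w)) (?i @ ([] @ w))"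
    by (intro bs_eq.cong bs_eq.refl bs_eq_letter_inv)
  with Cons show ?case by (auto intro: bs_eq.trans)
qed

lemma group_BS: "group (BS m n)"
proof (rule groupI)
  fix x assume "x \<in> carrier (BS m n)"
  then obtain w where "x = bs_class m n w" by (auto simp: carrier_BS)
  then have "bs_class m n (rev (map letter_inv w)) \<otimes>\<^bsub>BS m n\<^esub> x = \<one>\<^bsub>BS m n\<^esub>"
    by (simp add: mult_BS one_BS bs_class_eq_iff bs_eq_word_inv)
  then show "\<exists>y\<in>carrier (BS m n). y \<otimes>\<^bsub>BS m n\<^esub> x = \<one>\<^bsub>BS m n\<^esub>"
    by (auto simp: carrier_BS)
qed (auto simp: carrier_BS one_BS mult_BS)

definition word_height :: "letter list \<Rightarrow> int" where
  "word_height w = int (count_list w L_b) - int (count_list w L_b_inv)"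

text \<open>
  The map \<open>\<alpha>\<close> on words is given by recursion on the last letter, so the primitive
  recursion runs over the reversed word; see \<open>word_alpha_simps\<close> below.
\<close>
primrec alpha_rev :: "nat \<Rightarrow> nat \<Rightarrow> letter list \<Rightarrow> real" where
  "alpha_rev m n [] = 0"
| "alpha_rev m n (x # w) =
    (case x of
       L_a \<Rightarrow> alpha_rev m n w + (real n / real m) powi word_height (rev w)
     | L_a_inv \<Rightarrow> alpha_rev m n w - (real n / real m) powi word_height (rev w)
     | L_b \<Rightarrow> alpha_rev m n w
     | L_b_inv \<Rightarrow> alpha_rev m n w)"

definition word_alpha :: "nat \<Rightarrow> nat \<Rightarrow> letter list \<Rightarrow> real" where
  "word_alpha m n w = alpha_rev m n (rev w)"

lemma word_alpha_simps:
  "word_alpha m n [] = 0"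
  "word_alpha m n (w @ [L_b]) = word_alpha m n w"
  "word_alpha m n (w @ [L_b_inv]) = word_alpha m n w"
  "word_alpha m n (w @ [L_a]) = word_alpha m n w + (real n / real m) powi word_height w"
  "word_alpha m n (w @ [L_a_inv]) = word_alpha m n w - (real n / real m) powi word_height w"
  by (simp_all add: word_alpha_def)

text \<open>
  Both maps descend to the group (\<open>height_bs_class\<close>, \<open>alpha_bs_class\<close>), so the choice of the
  representing word is irrelevant.
\<close>
definition height :: "letter list set \<Rightarrow> int" where
  "height g = word_height (SOME w. w \<in> g)"

definition alpha :: "nat \<Rightarrow> nat \<Rightarrow> letter list set \<Rightarrow> real" where
  "alpha m n g = word_alpha m n (SOME w. w \<in> g)"

lemma word_height_append: "word_height (u @ v) = word_height u + word_height v"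
  by (simp add: word_height_def)

lemma count_list_replicate_neq: "x \<noteq> y \<Longrightarrow> count_list (replicate k y) x = 0"
  by (induction k) auto

lemma bs_eq_word_height: "bs_eq m n u v \<Longrightarrow> word_height u = word_height v"
  by (induction rule: bs_eq.induct)
    (auto simp: word_height_append, auto simp: word_height_def count_list_replicate_neq)

lemma word_alpha_append:
  assumes "m \<ge> 1" "n \<ge> 1"
  shows "word_alpha m n (u @ v) =
    word_alpha m n u + (real n / real m) powi word_height u * word_alpha m n v"
proof (induction v rule: rev_induct)
  case Nil
  show ?case by (simp add: word_alpha_simps)
next
  case (snoc x v)
  have "(real n / real m) powi word_height (u @ v) =
      (real n / real m) powi word_height u * (real n / real m) powi word_height v"
    using assms by (simp add: word_height_append power_int_add)
  with snoc show ?case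
    by (cases x) (simp_all add: word_alpha_simps algebra_simps flip: append_assoc)
qed

lemma word_alpha_replicate: "word_alpha m n (replicate k L_a) = real k"
proof (induction k)
  case (Suc k)
  have "word_alpha m n (replicate k L_a @ [L_a]) = real k + 1"
    using Suc by (simp add: word_alpha_simps word_height_def count_list_replicate_neq)
  then show ?case by (simp add: replicate_append_same)
qed (simp add: word_alpha_simps)

lemma bs_eq_word_alpha:
  assumes "m \<ge> 1" "n \<ge> 1" and "bs_eq m n u v"
  shows "word_alpha m n u = word_alpha m n v"
  using assms(3)
proof (induction rule: bs_eq.induct)
  case rel
  have "word_alpha m n [L_b] = 0" "word_alpha m n [L_b_inv] = 0" "word_height [L_b] = 1"
    by (simp_all add: word_alpha_def word_height_def)
  then have "word_alpha m n ([L_b] @ (replicate m L_a @ [L_b_inv])) = real n / real m * real m"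
    using assms by (simp only: word_alpha_append word_alpha_replicate) simp
  then show ?case using assms by (simp add: word_alpha_replicate)
next
  case (cong u u' v v')
  then show ?case using assms by (simp add: word_alpha_append bs_eq_word_height)
qed (auto simp: word_alpha_def word_height_def)

lemma some_in_bs_class: "bs_eq m n w (SOME v. v \<in> bs_class m n w)"
  using someI[of "\<lambda>v. v \<in> bs_class m n w" w] by (auto simp: bs_class_def bs_eq.refl)

lemma height_bs_class: "height (bs_class m n w) = word_height w"
  unfolding height_def using bs_eq_word_height[OF some_in_bs_class] by metis

lemma alpha_bs_class:
  "m \<ge> 1 \<Longrightarrow> n \<ge> 1 \<Longrightarrow> alpha m n (bs_class m n w) = word_alpha m n w"
  unfolding alpha_def using bs_eq_word_alpha[OF _ _ some_in_bs_class] by metis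

section \<open>Configurations and subshifts\<close>

text \<open>
  Configurations over an alphabet \<open>S\<close> are the elements of \<open>carrier G \<rightarrow>\<^sub>E S\<close>, i.e. they are
  \<open>undefined\<close> outside the carrier, so that they are determined by their values on the group.
\<close>
definition shift :: "('g, 'more) monoid_scheme \<Rightarrow> 'g \<Rightarrow> ('g \<Rightarrow> 's) \<Rightarrow> 'g \<Rightarrow> 's" where
  "shift G g x = (\<lambda>h\<in>carrier G. x (inv\<^bsub>G\<^esub> g \<otimes>\<^bsub>G\<^esub> h))"

definition strongly_periodic :: "('g, 'more) monoid_scheme \<Rightarrow> ('g \<Rightarrow> 's) \<Rightarrow> bool" where
  "strongly_periodic G x \<longleftrightarrow> finite (orbit G (shift G) x)"

definition finite_pattern :: "('g, 'more) monoid_scheme \<Rightarrow> 's set \<Rightarrow> ('g \<rightharpoonup> 's) \<Rightarrow> bool" where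
  "finite_pattern G S p \<longleftrightarrow> finite (dom p) \<and> dom p \<subseteq> carrier G \<and> ran p \<subseteq> S"

definition pattern_occurs ::
    "('g, 'more) monoid_scheme \<Rightarrow> ('g \<rightharpoonup> 's) \<Rightarrow> ('g \<Rightarrow> 's) \<Rightarrow> bool" where
  "pattern_occurs G p x \<longleftrightarrow> (\<exists>g\<in>carrier G. \<forall>h\<in>dom p. p h = Some (shift G g x h))"

definition is_SFT :: "('g, 'more) monoid_scheme \<Rightarrow> 's set \<Rightarrow> ('g \<Rightarrow> 's) set \<Rightarrow> bool" where
  "is_SFT G S X \<longleftrightarrow>
    finite S \<and>
    (\<exists>F. finite F \<and> (\<forall>p\<in>F. finite_pattern G S p) \<and>
         X = {x \<in> carrier G \<rightarrow>\<^sub>E S. \<forall>p\<in>F. \<not> pattern_occurs G p x})"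

definition weakly_aperiodic_SFT ::
    "('g, 'more) monoid_scheme \<Rightarrow> 's set \<Rightarrow> ('g \<Rightarrow> 's) set \<Rightarrow> bool" where
  "weakly_aperiodic_SFT G S X \<longleftrightarrow>
    is_SFT G S X \<and> X \<noteq> {} \<and> (\<forall>x\<in>X. \<not> strongly_periodic G x)"

section \<open>Wang tiles\<close>

text \<open>
  A tile \<open>(t\<^sub>1, \<dots>, t\<^sub>m, l, r, b\<^sub>1, \<dots>, b\<^sub>n)\<close> has its top and bottom colors in lists (indexed from
  1 by \<open>top_label\<close> and \<open>bottom_label\<close>). Top colors are only ever compared with bottom colors and left
  colors with right colors, so these may have different types.
\<close>
datatype ('v, 'h) wang_tile =
  Wang_Tile (tops: "'v list") (left_label: 'h) (right_label: 'h) (bottoms: "'v list")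

definition top_label :: "('v, 'h) wang_tile \<Rightarrow> nat \<Rightarrow> 'v" where
  "top_label s k = tops s ! (k - 1)"

definition bottom_label :: "('v, 'h) wang_tile \<Rightarrow> nat \<Rightarrow> 'v" where
  "bottom_label s j = bottoms s ! (j - 1)"

definition wang_space ::
    "nat \<Rightarrow> nat \<Rightarrow> ('v, 'h) wang_tile set \<Rightarrow> (letter list set \<Rightarrow> ('v, 'h) wang_tile) set" where
  "wang_space m n \<tau> =
    {T \<in> carrier (BS m n) \<rightarrow>\<^sub>E \<tau>.
      \<forall>g\<in>carrier (BS m n).
        right_label (T g) = left_label (T (g \<otimes>\<^bsub>BS m n\<^esub> bs_a m n [^]\<^bsub>BS m n\<^esub> m)) \<and>
        (\<forall>k\<in>{1..m}. \<forall>j\<in>{1..n}.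
          top_label (T g) k =
          bottom_label (T (g \<otimes>\<^bsub>BS m n\<^esub> bs_a m n [^]\<^bsub>BS m n\<^esub> (int k - int j) \<otimes>\<^bsub>BS m n\<^esub> bs_b m n)) j)}"

definition lam :: "nat \<Rightarrow> nat \<Rightarrow> letter list set \<Rightarrow> real" where
  "lam m n g = 1 / real m * (real m / real n) powi height g * alpha m n g"

definition tile_top :: "nat \<Rightarrow> nat \<Rightarrow> letter list set \<Rightarrow> real \<Rightarrow> nat \<Rightarrow> int" where
  "tile_top m n g x j =
    \<lfloor>(real m * lam m n g + real j) * x\<rfloor> - \<lfloor>(real m * lam m n g + real j - 1) * x\<rfloor>"

definition tile_bottom :: "nat \<Rightarrow> nat \<Rightarrow> rat \<Rightarrow> letter list set \<Rightarrow> real \<Rightarrow> nat \<Rightarrow> int" where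
  "tile_bottom m n q g x j =
    \<lfloor>(real n * lam m n g + real j) * of_rat q * x\<rfloor> -
    \<lfloor>(real n * lam m n g + real j - 1) * of_rat q * x\<rfloor>"

definition tile_left :: "nat \<Rightarrow> nat \<Rightarrow> rat \<Rightarrow> letter list set \<Rightarrow> real \<Rightarrow> real" where
  "tile_left m n q g x =
    of_rat q / real m * of_int \<lfloor>real m * lam m n g * x\<rfloor> -
    1 / real n * of_int \<lfloor>real n * lam m n g * of_rat q * x\<rfloor>"

definition tile_right :: "nat \<Rightarrow> nat \<Rightarrow> rat \<Rightarrow> letter list set \<Rightarrow> real \<Rightarrow> real" where
  "tile_right m n q g x =
    of_rat q / real m * of_int \<lfloor>(real m * lam m n g + real m) * x\<rfloor> -
    1 / real n * of_int \<lfloor>(real n * lam m n g + real n) * of_rat q * x\<rfloor>"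

definition tileset :: "nat \<Rightarrow> nat \<Rightarrow> rat \<Rightarrow> real set \<Rightarrow> (int, real) wang_tile set" where
  "tileset m n q I =
    {Wang_Tile (map (tile_top m n g x) [1..<m + 1]) (tile_left m n q g x) (tile_right m n q g x)
               (map (tile_bottom m n q g x) [1..<n + 1])
     | g x. g \<in> carrier (BS m n) \<and> x \<in> I}"

section \<open>The subshift of the system \<open>f\<^sub>1 x = 2 x\<close>, \<open>f\<^sub>2 x = x / 3\<close>\<close>

definition tileset_S0 :: "nat \<Rightarrow> nat \<Rightarrow> (int, real \<times> nat) wang_tile set" where
  "tileset_S0 m n =
    {Wang_Tile t (l, i) (r, i) b | t l r b i.
      (i = 1 \<and> Wang_Tile t l r b \<in> tileset m n 2 {0..1}) \<or>
      (i = 2 \<and> Wang_Tile t l r b \<in> tileset m n (1/3) {1..2})}"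

definition tile_color :: "('v, 'h \<times> nat) wang_tile \<Rightarrow> nat" where
  "tile_color s = snd (left_label s)"

definition Y_S0 :: "nat \<Rightarrow> nat \<Rightarrow> (letter list set \<Rightarrow> (int, real \<times> nat) wang_tile) set" where
  "Y_S0 m n =
    {T \<in> wang_space m n (tileset_S0 m n).
      \<forall>g\<in>carrier (BS m n). tile_color (T g) = 1 \<longrightarrow>
        (\<forall>j::int. \<exists>i\<in>{j, j + 1, j + 2}.
          top_label (T (g \<otimes>\<^bsub>BS m n\<^esub> bs_a m n [^]\<^bsub>BS m n\<^esub> i)) 1 = 1)}"

end

theory Submission
  imports Defs
begin

text \<open>
  A two-sided orbit \<open>x h = f (x (h + 1))\<close> of the system, with the tile of \<open>g\<close> computed from the real
  number at level \<open>height g\<close>, gives a configuration; on a line of color 1 that number is at least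
  \<open>1/3\<close>, so three consecutive floor differences add up to at least 1.

  Suppose \<open>T\<close> is strongly periodic, with period \<open>M\<close> along \<open>a\<close> and \<open>N\<close> along \<open>b\<close>, and let \<open>A g\<close> be the
  sum of \<open>M\<close> consecutive top labels on the line of \<open>g\<close>. Adding up the tile equations
  \<open>q/m \<Sum> tops - 1/n \<Sum> bottoms = right - left\<close> along a period gives \<open>A g = q A (g b)\<close> with \<open>q\<close> equal to
  2 or \<open>1/3\<close>, hence \<open>A g = 2\<^sup>i / 3\<^sup>j A g\<close> with \<open>i + j = N\<close> after \<open>N\<close> steps. As the restriction on
  lines of color 1 forces \<open>A g > 0\<close>, this is impossible.

  That restriction concerns a whole line, but the color is constant along \<open>g a\<^sup>m\<^sup>i\<close>, so it suffices to
  impose it on windows of \<open>m\<close> starting positions.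
\<close>

section \<open>Strong periodicity and subshifts of finite type\<close>

text \<open>\<open>x\<close> permutes the finite orbit, so some power \<open>x^N\<close> fixes every
  point of it, not only \<open>T\<close>. Fixing the translate of \<open>T\<close> by the inverse of
  \<open>g\<close> makes the conjugate of \<open>x^N\<close> by \<open>g\<close> a period of
  \<open>T\<close>. With \<open>h = g\<close> this is a period under right multiplication, with
  \<open>g\<close> the identity under left multiplication.\<close>

lemma strongly_periodic_power:
  assumes "group G" "strongly_periodic G T" and x: "x \<in> carrier G"
  shows "\<exists>N>0. \<forall>g\<in>carrier G. \<forall>h\<in>carrier G.
    T (g \<otimes>\<^bsub>G\<^esub> (x [^]\<^bsub>G\<^esub> (N::nat)) \<otimes>\<^bsub>G\<^esub> inv\<^bsub>G\<^esub> g \<otimes>\<^bsub>G\<^esub> h) = T h"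
proof -
  interpret group G by fact
  have fin: "finite (orbit G (shift G) T)" (is "finite ?O")
    using assms(2) by (simp add: strongly_periodic_def)
  have shift_shift: "shift G (g \<otimes>\<^bsub>G\<^esub> g') y = shift G g (shift G g' y)"
    if "g \<in> carrier G" "g' \<in> carrier G" for g g' and y :: "'a \<Rightarrow> 'c"
    using that by (auto simp: shift_def inv_mult_group m_assoc fun_eq_iff)
  have closed: "shift G g y \<in> ?O" if "g \<in> carrier G" "y \<in> ?O" for g y
    using that by (auto simp: orbit_def simp flip: shift_shift)
  have one: "shift G \<one>\<^bsub>G\<^esub> y = y" if "y \<in> ?O" for y
    using that by (auto simp: orbit_def simp flip: shift_shift)
  have "\<exists>d>0. shift G (x [^]\<^bsub>G\<^esub> (d::nat)) y = y" if y: "y \<in> ?O" for y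
  proof -
    \<comment> \<open>Pigeonhole: two powers of \<open>x\<close> send \<open>y\<close> to the same
      point, and the difference of their exponents then fixes \<open>y\<close>.\<close>
    have "range (\<lambda>k::nat. shift G (x [^]\<^bsub>G\<^esub> k) y) \<subseteq> ?O"
      using closed x y by auto
    then have "\<not> inj (\<lambda>k::nat. shift G (x [^]\<^bsub>G\<^esub> k) y)"
      using fin finite_imageD finite_subset infinite_UNIV_nat by blast
    then obtain k l :: nat where "k < l" and eq: "shift G (x [^]\<^bsub>G\<^esub> k) y = shift G (x [^]\<^bsub>G\<^esub> l) y"
      unfolding inj_def by (metis linorder_neqE_nat)
    then obtain d where d: "l = k + d" "d > 0" using less_imp_add_positive by blast
    have "shift G (inv\<^bsub>G\<^esub> (x [^]\<^bsub>G\<^esub> k)) (shift G (x [^]\<^bsub>G\<^esub> k) y) =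
        shift G (inv\<^bsub>G\<^esub> (x [^]\<^bsub>G\<^esub> k)) (shift G (x [^]\<^bsub>G\<^esub> k) (shift G (x [^]\<^bsub>G\<^esub> d) y))"
      using eq x by (simp add: d shift_shift flip: nat_pow_mult)
    then have "shift G (x [^]\<^bsub>G\<^esub> d) y = y"
      using x y by (simp add: closed one flip: shift_shift m_assoc)
    with d show ?thesis by blast
  qed
  then obtain d :: "('a \<Rightarrow> 'c) \<Rightarrow> nat"
    where d: "\<And>y. y \<in> ?O \<Longrightarrow> d y > 0 \<and> shift G (x [^]\<^bsub>G\<^esub> d y) y = y"
    by metis
  \<comment> \<open>A common multiple of the exponents \<open>d y\<close>, so that one power works
    at all points of the orbit.\<close>
  define N where "N = prod d ?O"
  have "N > 0" using d by (simp add: N_def prod_pos)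
  have fixed: "shift G (x [^]\<^bsub>G\<^esub> N) y = y" if y: "y \<in> ?O" for y
  proof -
    have "shift G (x [^]\<^bsub>G\<^esub> (d y * k)) y = y" for k
    proof (induction k)
      case (Suc k)
      have "shift G (x [^]\<^bsub>G\<^esub> (d y * Suc k)) y = shift G (x [^]\<^bsub>G\<^esub> (d y * k)) (shift G (x [^]\<^bsub>G\<^esub> d y) y)"
        using x by (simp add: nat_pow_mult add.commute flip: shift_shift)
      then show ?case using d y Suc by simp
    qed (simp add: one y)
    moreover have "d y dvd N" using y fin by (simp add: N_def dvd_prodI)
    ultimately show ?thesis by (auto elim!: dvdE)
  qed
  have "T (g \<otimes>\<^bsub>G\<^esub> x [^]\<^bsub>G\<^esub> N \<otimes>\<^bsub>G\<^esub> inv\<^bsub>G\<^esub> g \<otimes>\<^bsub>G\<^esub> h) = T h" if "g \<in> carrier G" "h \<in> carrier G" for g h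
  proof -
    have "shift G (inv\<^bsub>G\<^esub> g) T \<in> ?O" using that by (auto simp: orbit_def)
    \<comment> \<open>At this argument the two sides read \<open>T\<close> at \<open>h\<close> and
      at the conjugate times \<open>h\<close>.\<close>
    from fun_cong[OF fixed[OF this], of "x [^]\<^bsub>G\<^esub> N \<otimes>\<^bsub>G\<^esub> inv\<^bsub>G\<^esub> g \<otimes>\<^bsub>G\<^esub> h"] show ?thesis
      using that x by (simp add: shift_def m_assoc[symmetric] inv_solve_left)
  qed
  with \<open>N > 0\<close> show ?thesis by blast
qed

text \<open>The forbidden patterns are the assignments of letters to the finite window
  \<open>W\<close> that violate \<open>P\<close>. There are finitely many, and since
  \<open>P\<close> sees only \<open>W\<close>, their occurrences are exactly the failures of
  \<open>P\<close>.\<close>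

lemma is_SFT_local_rule:
  assumes "group G" "finite S" "finite W" "W \<subseteq> carrier G"
    and P: "\<And>y z. (\<And>h. h \<in> W \<Longrightarrow> y h = z h) \<Longrightarrow> P y = P z"
  shows "is_SFT G S {x \<in> carrier G \<rightarrow>\<^sub>E S. \<forall>g\<in>carrier G. P (\<lambda>h. x (g \<otimes>\<^bsub>G\<^esub> h))}"
proof -
  interpret group G by fact
  \<comment> \<open>Outside \<open>W\<close> the total function read off from \<open>p\<close> is
    arbitrary, which \<open>P\<close> cannot notice.\<close>
  define F where "F = {p. dom p = W \<and> ran p \<subseteq> S \<and> \<not> P (the \<circ> p)}"
  have "F \<subseteq> {p. dom p = W \<and> ran p \<subseteq> S}" by (auto simp: F_def)
  then have "finite F" using finite_set_of_finite_maps[OF assms(3,2)] finite_subset by blast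
  moreover have "\<forall>p\<in>F. finite_pattern G S p" using assms(3,4) by (auto simp: F_def finite_pattern_def)
  moreover have "(\<forall>g\<in>carrier G. P (\<lambda>h. x (g \<otimes>\<^bsub>G\<^esub> h))) \<longleftrightarrow> (\<forall>p\<in>F. \<not> pattern_occurs G p x)"
    if x: "x \<in> carrier G \<rightarrow>\<^sub>E S" for x
  proof
    assume *: "\<forall>g\<in>carrier G. P (\<lambda>h. x (g \<otimes>\<^bsub>G\<^esub> h))"
    show "\<forall>p\<in>F. \<not> pattern_occurs G p x"
    proof (intro ballI notI)
      fix p assume p: "p \<in> F" "pattern_occurs G p x"
      then obtain g where g: "g \<in> carrier G" "\<And>h. h \<in> W \<Longrightarrow> p h = Some (shift G g x h)"
        by (auto simp: F_def pattern_occurs_def)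
      have "P (the \<circ> p) = P (\<lambda>h. x (inv\<^bsub>G\<^esub> g \<otimes>\<^bsub>G\<^esub> h))"
        using g assms(4) by (intro P) (auto simp: shift_def)
      then show False using * p g by (auto simp: F_def)
    qed
  next
    assume *: "\<forall>p\<in>F. \<not> pattern_occurs G p x"
    show "\<forall>g\<in>carrier G. P (\<lambda>h. x (g \<otimes>\<^bsub>G\<^esub> h))"
    proof (intro ballI, rule ccontr)
      fix g assume g: "g \<in> carrier G" "\<not> P (\<lambda>h. x (g \<otimes>\<^bsub>G\<^esub> h))"
      define p where "p = (\<lambda>h. if h \<in> W then Some (x (g \<otimes>\<^bsub>G\<^esub> h)) else None)"
      have "P (the \<circ> p) = P (\<lambda>h. x (g \<otimes>\<^bsub>G\<^esub> h))" by (intro P) (auto simp: p_def)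
      then have "p \<in> F"
        using g x assms(4) by (auto simp: F_def p_def ran_def dom_def split: if_splits)
      \<comment> \<open>A shift by an element reads \<open>x\<close> at its inverse times
        \<open>h\<close>, so the witness is the inverse of \<open>g\<close>.\<close>
      moreover have "pattern_occurs G p x"
        unfolding pattern_occurs_def using g assms(4)
        by (intro bexI[of _ "inv\<^bsub>G\<^esub> g"]) (auto simp: p_def shift_def split: if_splits)
      ultimately show False using * by blast
    qed
  qed
  ultimately show ?thesis
    unfolding is_SFT_def using assms(2) by (intro conjI exI[of _ F]) auto
qed

section \<open>The group\<close>

locale baumslag_solitar =
  fixes m n :: nat
  assumes m_pos: "m \<ge> 1" and n_pos: "n \<ge> 1"
begin

abbreviation "G \<equiv> BS m n"
abbreviation "a \<equiv> bs_a m n"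
abbreviation "b \<equiv> bs_b m n"

sublocale group G by (rule group_BS)

lemma gen_closed [simp]: "a \<in> carrier G" "b \<in> carrier G"
  by (auto simp: carrier_BS)

lemma a_pow_nat: "a [^]\<^bsub>G\<^esub> (k::nat) = bs_class m n (replicate k L_a)"
  by (induction k) (simp_all add: one_BS mult_BS replicate_append_same)

lemma pow_n_b: "a [^]\<^bsub>G\<^esub> n \<otimes>\<^bsub>G\<^esub> b = b \<otimes>\<^bsub>G\<^esub> a [^]\<^bsub>G\<^esub> m"
proof -
  have "bs_eq m n ((L_b # replicate m L_a) @ [L_b_inv, L_b]) ((L_b # replicate m L_a) @ [])"
    by (intro bs_eq.cong bs_eq.refl bs_eq.b_inv_b)
  moreover have "bs_eq m n ((L_b # replicate m L_a @ [L_b_inv]) @ [L_b]) (replicate n L_a @ [L_b])"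
    by (intro bs_eq.cong bs_eq.refl bs_eq.rel)
  ultimately have "bs_eq m n (replicate n L_a @ [L_b]) ([L_b] @ replicate m L_a)"
    by simp (meson bs_eq.sym bs_eq.trans)
  then show ?thesis by (simp add: a_pow_nat mult_BS bs_class_eq_iff)
qed

text \<open>Iterating the defining relation matches the \<open>k\<close>-th block of
  \<open>n\<close> positions on the line of \<open>g\<close> with the \<open>k\<close>-th block of
  \<open>m\<close> positions on the line of \<open>g b\<close>.\<close>

lemma pow_mult_b:
  assumes "g \<in> carrier G"
  shows "g \<otimes>\<^bsub>G\<^esub> a [^]\<^bsub>G\<^esub> int (n * k) \<otimes>\<^bsub>G\<^esub> b = g \<otimes>\<^bsub>G\<^esub> b \<otimes>\<^bsub>G\<^esub> a [^]\<^bsub>G\<^esub> int (m * k)"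
proof -
  have "a [^]\<^bsub>G\<^esub> (n * k) \<otimes>\<^bsub>G\<^esub> b = b \<otimes>\<^bsub>G\<^esub> a [^]\<^bsub>G\<^esub> (m * k)"
  proof (induction k)
    case (Suc k)
    have "a [^]\<^bsub>G\<^esub> (n * Suc k) = a [^]\<^bsub>G\<^esub> (n * k) \<otimes>\<^bsub>G\<^esub> a [^]\<^bsub>G\<^esub> n"
      by (simp add: nat_pow_mult add.commute)
    then have "a [^]\<^bsub>G\<^esub> (n * Suc k) \<otimes>\<^bsub>G\<^esub> b = a [^]\<^bsub>G\<^esub> (n * k) \<otimes>\<^bsub>G\<^esub> (a [^]\<^bsub>G\<^esub> n \<otimes>\<^bsub>G\<^esub> b)"
      by (simp add: m_assoc)
    also have "\<dots> = a [^]\<^bsub>G\<^esub> (n * k) \<otimes>\<^bsub>G\<^esub> b \<otimes>\<^bsub>G\<^esub> a [^]\<^bsub>G\<^esub> m"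
      by (simp add: pow_n_b m_assoc)
    also have "\<dots> = b \<otimes>\<^bsub>G\<^esub> a [^]\<^bsub>G\<^esub> (m * Suc k)"
      by (simp add: Suc m_assoc nat_pow_mult add.commute)
    finally show ?case .
  qed simp
  then show ?thesis using assms by (simp add: m_assoc int_pow_int del: of_nat_mult)
qed

lemma a_pow_add:
  "g \<in> carrier G \<Longrightarrow>
    g \<otimes>\<^bsub>G\<^esub> a [^]\<^bsub>G\<^esub> (i::int) \<otimes>\<^bsub>G\<^esub> a [^]\<^bsub>G\<^esub> (j::int) = g \<otimes>\<^bsub>G\<^esub> a [^]\<^bsub>G\<^esub> (i + j)"
  by (simp add: m_assoc int_pow_mult)

section \<open>Height, \<open>alpha\<close> and \<open>lam\<close> under multiplication by the
  generators\<close>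

lemmas alpha_class = alpha_bs_class[OF m_pos n_pos]

lemma height_mult:
  "g \<in> carrier G \<Longrightarrow> h \<in> carrier G \<Longrightarrow> height (g \<otimes>\<^bsub>G\<^esub> h) = height g + height h"
  by (auto simp: carrier_BS mult_BS height_bs_class word_height_append)

lemma alpha_mult:
  "g \<in> carrier G \<Longrightarrow> h \<in> carrier G \<Longrightarrow>
    alpha m n (g \<otimes>\<^bsub>G\<^esub> h) = alpha m n g + (real n / real m) powi height g * alpha m n h"
  by (auto simp: carrier_BS mult_BS height_bs_class alpha_class word_alpha_append[OF m_pos n_pos])

lemma height_b: "height b = 1" and alpha_b: "alpha m n b = 0"
  by (simp_all add: height_bs_class alpha_class word_height_def word_alpha_def)

lemma height_one: "height \<one>\<^bsub>G\<^esub> = 0" and alpha_one: "alpha m n \<one>\<^bsub>G\<^esub> = 0"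
  by (simp_all add: one_BS height_bs_class alpha_class word_height_def word_alpha_def)

lemma height_a_pow: "height (a [^]\<^bsub>G\<^esub> (i::int)) = 0"
  and alpha_a_pow: "alpha m n (a [^]\<^bsub>G\<^esub> (i::int)) = of_int i"
proof -
  have nat: "height (a [^]\<^bsub>G\<^esub> int k) = 0" "alpha m n (a [^]\<^bsub>G\<^esub> int k) = real k" for k
    by (simp_all add: int_pow_int a_pow_nat height_bs_class alpha_class
        word_alpha_replicate word_height_def count_list_replicate_neq)
  \<comment> \<open>Negative exponents follow from the product rules applied to this
    identity.\<close>
  have "a [^]\<^bsub>G\<^esub> int k \<otimes>\<^bsub>G\<^esub> a [^]\<^bsub>G\<^esub> (- int k) = \<one>\<^bsub>G\<^esub>" for k
    by (simp flip: int_pow_mult)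
  then have "height (a [^]\<^bsub>G\<^esub> (- int k)) = 0 \<and> alpha m n (a [^]\<^bsub>G\<^esub> (- int k)) = - real k" for k
    using height_mult[of "a [^]\<^bsub>G\<^esub> int k" "a [^]\<^bsub>G\<^esub> (- int k)"]
      alpha_mult[of "a [^]\<^bsub>G\<^esub> int k" "a [^]\<^bsub>G\<^esub> (- int k)"] nat[of k]
    by (simp add: height_one alpha_one)
  with nat show "height (a [^]\<^bsub>G\<^esub> i) = 0" "alpha m n (a [^]\<^bsub>G\<^esub> i) = of_int i"
    by (cases i rule: int_cases2; simp)+
qed

lemma height_mult_a_pow: "g \<in> carrier G \<Longrightarrow> height (g \<otimes>\<^bsub>G\<^esub> a [^]\<^bsub>G\<^esub> (i::int)) = height g"
  by (simp add: height_mult height_a_pow)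

text \<open>A step along \<open>a\<close> changes \<open>alpha\<close> by \<open>n/m\<close> to the
  power of the height, which the prefactor of \<open>lam\<close> cancels: the step is
  \<open>1/m\<close> on every line.\<close>

lemma lam_mult_a_pow:
  assumes "g \<in> carrier G"
  shows "lam m n (g \<otimes>\<^bsub>G\<^esub> a [^]\<^bsub>G\<^esub> (i::int)) = lam m n g + of_int i / real m"
proof -
  have "(real m / real n) powi height g * (real n / real m) powi height g = 1"
    using m_pos n_pos by (simp flip: power_int_mult_distrib)
  then have "(real m / real n) powi height g * ((real n / real m) powi height g * of_int i) = of_int i"
    by (simp flip: mult.assoc)
  then show ?thesis
    using assms
    by (simp add: lam_def alpha_mult alpha_a_pow height_mult height_a_pow ring_distribs add_divide_distrib)
qed

text \<open>\<open>b\<close> keeps \<open>alpha\<close> and raises the height by one, which scales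
  \<open>lam\<close> by \<open>m/n\<close>. Hence the bottom floors at \<open>g b\<close> and the
  top floors at \<open>g\<close> are taken at the same positions.\<close>

lemma lam_mult_b:
  assumes "g \<in> carrier G"
  shows "real n * lam m n (g \<otimes>\<^bsub>G\<^esub> b) = real m * lam m n g"
  using assms m_pos n_pos
  by (simp add: lam_def alpha_mult alpha_b height_mult height_b power_int_add)

end

section \<open>Tiles\<close>

lemma top_label_Wang_Tile:
  "k \<in> {1..m} \<Longrightarrow> top_label (Wang_Tile (map f [1..<m + 1]) l r bs) k = f k"
  by (auto simp: top_label_def simp del: upt_Suc)

lemma bottom_label_Wang_Tile:
  "k \<in> {1..n} \<Longrightarrow> bottom_label (Wang_Tile ts l r (map f [1..<n + 1])) k = f k"
  by (auto simp: bottom_label_def simp del: upt_Suc)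

section \<open>Finiteness of the tilesets\<close>

lemma finite_bounded_fractions: "finite {y :: real. \<bar>y\<bar> \<le> C \<and> (\<exists>k. y = of_int k / of_int D)}"
proof (cases "D = 0")
  case True
  have "{y :: real. \<bar>y\<bar> \<le> C \<and> (\<exists>k. y = of_int k / of_int D)} \<subseteq> {0}" using True by auto
  then show ?thesis using finite_subset by blast
next
  case False
  let ?B = "\<lceil>C * \<bar>of_int D\<bar>\<rceil>"
  have "{y :: real. \<bar>y\<bar> \<le> C \<and> (\<exists>k. y = of_int k / of_int D)}
      \<subseteq> (\<lambda>k. of_int k / of_int D) ` {-?B..?B}"
  proof
    fix y :: real assume "y \<in> {y. \<bar>y\<bar> \<le> C \<and> (\<exists>k. y = of_int k / of_int D)}"
    then obtain k where k: "y = of_int k / of_int D" "\<bar>y\<bar> \<le> C" by blast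
    then have "of_int k = y * of_int D" using False by simp
    then have "\<bar>of_int k\<bar> \<le> C * \<bar>of_int D\<bar>" using k(2) by (simp add: abs_mult mult_right_mono)
    then have "k \<in> {-?B..?B}" by (auto simp: abs_le_iff) linarith+
    with k show "y \<in> (\<lambda>k. of_int k / of_int D) ` {-?B..?B}" by blast
  qed
  then show ?thesis using finite_subset by blast
qed

text \<open>Writing each floor as its argument minus a fractional part, the main terms
  \<open>q z\<close> cancel and only \<open>e'/n - q e/m\<close> remains. Applied to left and right
  labels, it confines them to a finite set that does not depend on \<open>g\<close> and
  \<open>x\<close>.\<close>

lemma floor_combination_bounded_fraction:
  fixes q :: rat and z :: real
  assumes "m \<ge> 1" "n \<ge> 1" and q: "quotient_of q = (p, d)"
  defines "y \<equiv> of_rat q / real m * of_int \<lfloor>real m * z\<rfloor> - 1 / real n * of_int \<lfloor>real n * z * of_rat q\<rfloor>"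
  shows "\<bar>y\<bar> \<le> \<bar>of_rat q\<bar> + 1 \<and> (\<exists>k. y = of_int k / of_int (d * int m * int n))"
proof -
  define e where "e = real m * z - of_int \<lfloor>real m * z\<rfloor>"
  define e' where "e' = real n * z * of_rat q - of_int \<lfloor>real n * z * of_rat q\<rfloor>"
  have e: "0 \<le> e" "e \<le> 1" "0 \<le> e'" "e' \<le> 1" unfolding e_def e'_def by linarith+
  have y: "y = e' / real n - of_rat q * (e / real m)"
    using assms(1,2) by (simp add: y_def e_def e'_def field_simps)
  have le1: "e / real m \<le> 1" "e' / real n \<le> 1" using e assms(1,2) by (simp_all add: divide_simps)
  have "\<bar>of_rat q * (e / real m)\<bar> \<le> \<bar>of_rat q\<bar> * 1"
    unfolding abs_mult using e le1 by (intro mult_left_mono) auto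
  moreover have "\<bar>e' / real n\<bar> \<le> 1" using e le1 by simp
  ultimately have "\<bar>y\<bar> \<le> \<bar>of_rat q\<bar> + 1" unfolding y by linarith
  moreover have "d > 0" using q by (rule quotient_of_denom_pos)
  moreover have "of_rat q = (of_int p / of_int d :: real)"
    using quotient_of_div[OF q] by (simp add: of_rat_divide)
  then have "y = of_int (p * int n * \<lfloor>real m * z\<rfloor> - d * int m * \<lfloor>real n * z * of_rat q\<rfloor>)
      / of_int (d * int m * int n)"
    using assms(1,2) \<open>d > 0\<close> by (simp add: y_def field_simps)
  ultimately show ?thesis by blast
qed

lemma floor_diff_bounded:
  fixes y z :: real
  assumes "\<bar>z\<bar> \<le> C" "y' = y + z"
  shows "\<lfloor>y'\<rfloor> - \<lfloor>y\<rfloor> \<in> {- \<lceil>C\<rceil> - 1..\<lceil>C\<rceil> + 1}"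
proof -
  have "real_of_int (\<lfloor>y'\<rfloor> - \<lfloor>y\<rfloor>) < of_int (\<lceil>C\<rceil> + 2)" "of_int (- \<lceil>C\<rceil> - 2) < real_of_int (\<lfloor>y'\<rfloor> - \<lfloor>y\<rfloor>)"
    using assms by (simp_all only: of_int_diff of_int_add of_int_minus of_int_numeral) linarith+
  then show ?thesis unfolding of_int_less_iff by simp
qed

text \<open>Although \<open>g\<close> and possibly \<open>x\<close> range over infinite sets, the
  top and bottom labels are bounded integers and the side labels are bounded fractions with a fixed
  denominator.\<close>

lemma finite_tileset:
  assumes m: "m \<ge> 1" and n: "n \<ge> 1" and I: "I \<subseteq> {-C..C}"
  shows "finite (tileset m n q I)"
proof -
  obtain p d where q: "quotient_of q = (p, d)" by force
  let ?K = "\<lambda>C. {- \<lceil>C\<rceil> - 1..\<lceil>C\<rceil> + 1}"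
  let ?L = "\<lambda>C k. {ts :: int list. set ts \<subseteq> ?K C \<and> length ts = k}"
  let ?H = "{y :: real. \<bar>y\<bar> \<le> \<bar>of_rat q\<bar> + 1 \<and> (\<exists>k. y = of_int k / of_int (d * int m * int n))}"
  let ?q = "of_rat q :: real"
  let ?P = "?L C m \<times> ?H \<times> ?H \<times> ?L (\<bar>?q\<bar> * C) n"
  have "tileset m n q I \<subseteq> (\<lambda>(t, l, r, b). Wang_Tile t l r b) ` ?P"
  proof
    fix s assume "s \<in> tileset m n q I"
    then obtain g x where x: "x \<in> I" and s: "s = Wang_Tile (map (tile_top m n g x) [1..<m + 1])
        (tile_left m n q g x) (tile_right m n q g x) (map (tile_bottom m n q g x) [1..<n + 1])"
      by (auto simp: tileset_def)
    have xC: "\<bar>x\<bar> \<le> C" using x I by (auto simp: abs_le_iff)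
    have qxC: "\<bar>?q * x\<bar> \<le> \<bar>?q\<bar> * C" unfolding abs_mult using xC by (intro mult_left_mono) auto
    have "tile_top m n g x j \<in> ?K C" for j
      unfolding tile_top_def by (rule floor_diff_bounded[OF xC]) (simp add: algebra_simps)
    moreover have "tile_bottom m n q g x j \<in> ?K (\<bar>?q\<bar> * C)" for j
      unfolding tile_bottom_def by (rule floor_diff_bounded[OF qxC]) (simp add: algebra_simps)
    moreover have "tile_left m n q g x \<in> ?H"
      using floor_combination_bounded_fraction[OF m n q, of "lam m n g * x"]
      by (simp add: tile_left_def ac_simps)
    moreover have "tile_right m n q g x \<in> ?H"
      using floor_combination_bounded_fraction[OF m n q, of "(lam m n g + 1) * x"]
      by (simp add: tile_right_def algebra_simps)
    ultimately have "(map (tile_top m n g x) [1..<m + 1], tile_left m n q g x, tile_right m n q g x,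
        map (tile_bottom m n q g x) [1..<n + 1]) \<in> ?P"
      by (auto simp del: upt_Suc)
    then show "s \<in> (\<lambda>(t, l, r, b). Wang_Tile t l r b) ` ?P"
      unfolding s by (rule rev_image_eqI) simp
  qed
  moreover have "finite ?P"
    by (intro finite_cartesian_product finite_lists_length_eq finite_bounded_fractions) auto
  ultimately show ?thesis by (rule finite_surj[rotated])
qed

lemma finite_tileset_S0:
  assumes "m \<ge> 1" "n \<ge> 1"
  shows "finite (tileset_S0 m n)"
proof -
  have "finite (tileset m n 2 {0..1})" "finite (tileset m n (1/3) {1..2})"
    using assms by (auto intro!: finite_tileset[where C = 2])
  moreover have "tileset_S0 m n \<subseteq>
      (\<lambda>s. Wang_Tile (tops s) (left_label s, 1) (right_label s, 1) (bottoms s)) ` tileset m n 2 {0..1} \<union>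
      (\<lambda>s. Wang_Tile (tops s) (left_label s, 2) (right_label s, 2) (bottoms s)) ` tileset m n (1/3) {1..2}"
    by (force simp: tileset_S0_def)
  ultimately show ?thesis using finite_subset by blast
qed

section \<open>The tile equation and lower bounds for top labels\<close>

lemma sum_floor_diff:
  fixes y x :: real
  shows "(\<Sum>j=1..k. \<lfloor>(y + real j) * x\<rfloor> - \<lfloor>(y + real j - 1) * x\<rfloor>) = \<lfloor>(y + real k) * x\<rfloor> - \<lfloor>y * x\<rfloor>"
proof (induction k)
  case (Suc k)
  have "y + real (Suc k) - 1 = y + real k" by simp
  with Suc show ?case by simp
qed simp

text \<open>Both sums telescope to floors at the two ends of the tile, which are the floors that
  make up the left and right labels.\<close>

lemma tileset_balance:
  assumes "s \<in> tileset m n q I"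
  shows "of_rat q / real m * of_int (\<Sum>k=1..m. top_label s k) -
    1 / real n * of_int (\<Sum>j=1..n. bottom_label s j) = right_label s - left_label s"
proof -
  obtain g x where s: "s = Wang_Tile (map (tile_top m n g x) [1..<m + 1])
      (tile_left m n q g x) (tile_right m n q g x) (map (tile_bottom m n q g x) [1..<n + 1])"
    using assms by (auto simp: tileset_def)
  have "(\<Sum>k=1..m. top_label s k) = (\<Sum>k=1..m. tile_top m n g x k)"
    unfolding s by (rule sum.cong) (simp_all only: top_label_Wang_Tile)
  moreover have "(\<Sum>j=1..n. bottom_label s j) = (\<Sum>j=1..n. tile_bottom m n q g x j)"
    unfolding s by (rule sum.cong) (simp_all only: bottom_label_Wang_Tile)
  ultimately show ?thesis
    by (simp only: tile_top_def tile_bottom_def mult.assoc sum_floor_diff)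
      (simp add: s tile_left_def tile_right_def algebra_simps)
qed

text \<open>The factor of the map encoded by a color. All colors other than 1 share the value
  \<open>1/3\<close>, so case distinctions only test for color 1.\<close>

definition rate :: "nat \<Rightarrow> real" where
  "rate i = (if i = 1 then 2 else 1 / 3)"

lemma tileset_S0_cases:
  assumes "s \<in> tileset_S0 m n"
  obtains t l r b i where "s = Wang_Tile t (l, i) (r, i) b"
    "i = 1 \<and> Wang_Tile t l r b \<in> tileset m n 2 {0..1} \<or>
     i = 2 \<and> Wang_Tile t l r b \<in> tileset m n (1/3) {1..2}"
  using assms by (auto simp: tileset_S0_def)

lemma color_right:
  assumes "s \<in> tileset_S0 m n"
  shows "snd (right_label s) = tile_color s"
  using assms by (auto simp: tileset_S0_def tile_color_def)

lemma tileset_S0_balance: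
  assumes "s \<in> tileset_S0 m n"
  shows "rate (tile_color s) / real m * of_int (\<Sum>k=1..m. top_label s k) -
    1 / real n * of_int (\<Sum>j=1..n. bottom_label s j) = fst (right_label s) - fst (left_label s)"
  using assms
proof (cases rule: tileset_S0_cases)
  case (1 t l r b i)
  then show ?thesis
    by (auto simp: rate_def tile_color_def top_label_def bottom_label_def of_rat_divide
        dest!: tileset_balance)
qed

text \<open>One step along the line adds \<open>x\<close> to the argument of the floor, and
  \<open>x\<close> is at least the integer \<open>c\<close>. Used with \<open>c\<close> equal to 0
  and 1.\<close>

lemma tileset_top_ge:
  assumes "m \<ge> 1" "s \<in> tileset m n q {real_of_int c..d}"
  shows "top_label s 1 \<ge> c"
proof -
  obtain g x where x: "x \<ge> real_of_int c" and s: "s = Wang_Tile (map (tile_top m n g x) [1..<m + 1])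
      (tile_left m n q g x) (tile_right m n q g x) (map (tile_bottom m n q g x) [1..<n + 1])"
    using assms by (auto simp: tileset_def)
  have "\<lfloor>real m * lam m n g * x + of_int c\<rfloor> \<le> \<lfloor>(real m * lam m n g + 1) * x\<rfloor>"
    using x by (intro floor_mono) (simp add: algebra_simps)
  then have "\<lfloor>real m * lam m n g * x\<rfloor> + c \<le> \<lfloor>(real m * lam m n g + 1) * x\<rfloor>" by simp
  moreover have "top_label s 1 = tile_top m n g x 1" unfolding s using assms(1) by (intro top_label_Wang_Tile) simp
  ultimately show ?thesis by (simp add: tile_top_def)
qed

lemma tileset_S0_top_nonneg:
  assumes "m \<ge> 1" "s \<in> tileset_S0 m n"
  shows "top_label s 1 \<ge> 0"
  using assms(2)
proof (cases rule: tileset_S0_cases)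
  case (1 t l r b i)
  then show ?thesis
    using tileset_top_ge[OF assms(1), of "Wang_Tile t l r b" n 2 0 1]
      tileset_top_ge[OF assms(1), of "Wang_Tile t l r b" n "1/3" 1 2]
    by (auto simp: top_label_def)
qed

lemma tileset_S0_top_pos:
  assumes "m \<ge> 1" "s \<in> tileset_S0 m n" "tile_color s \<noteq> 1"
  shows "top_label s 1 \<ge> 1"
  using assms(2)
proof (cases rule: tileset_S0_cases)
  case (1 t l r b i)
  then show ?thesis
    using tileset_top_ge[OF assms(1), of "Wang_Tile t l r b" n "1/3" 1 2] assms(3)
    by (auto simp: top_label_def tile_color_def)
qed

section \<open>Aperiodicity\<close>

lemma sum_lessThan_mult:
  fixes f :: "nat \<Rightarrow> 'a::comm_monoid_add"
  shows "(\<Sum>l<N * k. f l) = (\<Sum>i<N. \<Sum>j<k. f (k * i + j))"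
proof -
  have "sum f {i * k..<i * k + k} = (\<Sum>j<k. f (k * i + j))" for i
    by (subst sum.atLeastLessThan_shift_0) (simp add: atLeast0LessThan mult.commute)
  then show ?thesis by (simp flip: sum.nat_group)
qed

lemma sum_periodic:
  fixes f :: "nat \<Rightarrow> 'a::comm_semiring_1"
  assumes "\<And>l. f (l + M) = f l"
  shows "(\<Sum>l<N * M. f l) = of_nat N * (\<Sum>l<M. f l)"
proof -
  have "f (M * i + j) = f j" for i j
  proof (induction i)
    case (Suc i)
    then show ?case using assms[of "M * i + j"] by (simp add: add_ac)
  qed simp
  then show ?thesis by (simp add: sum_lessThan_mult)
qed

text \<open>Parity: a power of 3 is odd, so equality with a power of 2 forces both exponents to be
  0.\<close>

lemma pow2_div_pow3_neq_1:
  assumes "i + j > 0"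
  shows "2 ^ i / 3 ^ j \<noteq> (1 :: real)"
proof
  assume "2 ^ i / 3 ^ j = (1 :: real)"
  then have "real (2 ^ i) = real (3 ^ j)" by simp
  then have eq: "(2::nat) ^ i = 3 ^ j" by (simp only: of_nat_eq_iff)
  then have "even ((2::nat) ^ i) = even ((3::nat) ^ j)" by simp
  then have "i = 0" by simp
  with eq have "j = 0" by (cases j) auto
  with \<open>i = 0\<close> assms show False by simp
qed

context baumslag_solitar
begin

section \<open>Labels and colors along a line\<close>

lemma wang_space_horizontal:
  assumes "T \<in> wang_space m n \<tau>" "g \<in> carrier G"
  shows "right_label (T g) = left_label (T (g \<otimes>\<^bsub>G\<^esub> a [^]\<^bsub>G\<^esub> int m))"
  using assms by (simp add: wang_space_def int_pow_int)

lemma wang_space_vertical: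
  assumes "T \<in> wang_space m n \<tau>" "g \<in> carrier G" "k \<in> {1..m}" "j \<in> {1..n}"
  shows "top_label (T g) k =
    bottom_label (T (g \<otimes>\<^bsub>G\<^esub> a [^]\<^bsub>G\<^esub> (int k - int j) \<otimes>\<^bsub>G\<^esub> b)) j"
  using assms by (simp add: wang_space_def)

lemma wang_space_tile: "T \<in> wang_space m n \<tau> \<Longrightarrow> g \<in> carrier G \<Longrightarrow> T g \<in> \<tau>"
  by (auto simp: wang_space_def)

text \<open>Both labels equal bottom label 1 of the tile at \<open>g a^(k-1) b\<close>. So the first
  top labels alone describe a whole line.\<close>

lemma top_label_eq_top_label_1:
  assumes "T \<in> wang_space m n \<tau>" "g \<in> carrier G" "k \<in> {1..m}"
  shows "top_label (T g) k = top_label (T (g \<otimes>\<^bsub>G\<^esub> a [^]\<^bsub>G\<^esub> (int k - 1))) 1"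
  using wang_space_vertical[OF assms, of 1]
    wang_space_vertical[OF assms(1), of "g \<otimes>\<^bsub>G\<^esub> a [^]\<^bsub>G\<^esub> (int k - 1)" 1 1] assms m_pos n_pos
  by simp

lemma bottom_label_eq_top_label_1:
  assumes "T \<in> wang_space m n \<tau>" "g \<in> carrier G" "j \<in> {1..n}"
  shows "bottom_label (T (g \<otimes>\<^bsub>G\<^esub> b)) j = top_label (T (g \<otimes>\<^bsub>G\<^esub> a [^]\<^bsub>G\<^esub> (int j - 1))) 1"
  using wang_space_vertical[OF assms(1), of "g \<otimes>\<^bsub>G\<^esub> a [^]\<^bsub>G\<^esub> (int j - 1)" 1 j] assms m_pos
  by (simp add: a_pow_add)

text \<open>Both sides of a tile carry its color, and the horizontal rule passes it on between
  positions \<open>m\<close> apart; hence only exponents divisible by \<open>m\<close>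
  appear.\<close>

lemma tile_color_line:
  assumes T: "T \<in> wang_space m n (tileset_S0 m n)" and g: "g \<in> carrier G"
  shows "tile_color (T (g \<otimes>\<^bsub>G\<^esub> a [^]\<^bsub>G\<^esub> (int m * i))) = tile_color (T g)"
proof -
  have step: "tile_color (T (h \<otimes>\<^bsub>G\<^esub> a [^]\<^bsub>G\<^esub> int m)) = tile_color (T h)" if "h \<in> carrier G" for h
    using color_right[OF wang_space_tile[OF T that]] wang_space_horizontal[OF T that]
    by (simp add: tile_color_def)
  show ?thesis
  proof (induction i rule: int_induct[where k = 0])
    case base
    show ?case using g by simp
  next
    case (step1 i)
    then show ?case
      using step[of "g \<otimes>\<^bsub>G\<^esub> a [^]\<^bsub>G\<^esub> (int m * i)"] g by (simp add: a_pow_add algebra_simps)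
  next
    case (step2 i)
    then show ?case
      using step[of "g \<otimes>\<^bsub>G\<^esub> a [^]\<^bsub>G\<^esub> (int m * (i - 1))"] g by (simp add: a_pow_add algebra_simps)
  qed
qed

section \<open>Label sums over a horizontal period\<close>

definition line_sum :: "(letter list set \<Rightarrow> (int, 'h) wang_tile) \<Rightarrow> nat \<Rightarrow> letter list set \<Rightarrow> real" where
  "line_sum T M g = (\<Sum>l<M. of_int (top_label (T (g \<otimes>\<^bsub>G\<^esub> a [^]\<^bsub>G\<^esub> int l)) 1))"

text \<open>Take \<open>M\<close> tiles, \<open>m\<close> steps apart, on the line of
  \<open>g b\<close>. Their tops cover \<open>m * M\<close> positions of that line, their bottoms
  \<open>n * M\<close> positions of the line of \<open>g\<close>. Adding the tile equations, the
  side labels telescope to 0 by periodicity. The two sums are \<open>m\<close> and \<open>n\<close>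
  times a sum over one period, which cancels the factors \<open>1/m\<close> and
  \<open>1/n\<close>.\<close>

lemma line_sum_mult_b:
  assumes T: "T \<in> wang_space m n (tileset_S0 m n)" and g: "g \<in> carrier G"
    and per: "\<And>h. h \<in> carrier G \<Longrightarrow> T (h \<otimes>\<^bsub>G\<^esub> a [^]\<^bsub>G\<^esub> int M) = T h"
  shows "rate (tile_color (T (g \<otimes>\<^bsub>G\<^esub> b))) * line_sum T M (g \<otimes>\<^bsub>G\<^esub> b) = line_sum T M g"
proof -
  define u :: "letter list set \<Rightarrow> nat \<Rightarrow> real"
    where "u h l = of_int (top_label (T (h \<otimes>\<^bsub>G\<^esub> a [^]\<^bsub>G\<^esub> int l)) 1)" for h l
  define g' where "g' = g \<otimes>\<^bsub>G\<^esub> b"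
  have g': "g' \<in> carrier G" using g by (simp add: g'_def)
  have u_per: "u h (l + M) = u h l" if "h \<in> carrier G" for h l
    using per[of "h \<otimes>\<^bsub>G\<^esub> a [^]\<^bsub>G\<^esub> int l"] that by (simp add: u_def a_pow_add)
  define L where "L i = fst (left_label (T (g' \<otimes>\<^bsub>G\<^esub> a [^]\<^bsub>G\<^esub> int (m * i))))" for i
  let ?r = "rate (tile_color (T g'))"
  have tile: "?r / real m * (\<Sum>k<m. u g' (m * i + k)) - 1 / real n * (\<Sum>j<n. u g (n * i + j)) =
      L (Suc i) - L i" for i
  proof -
    define h where "h = g' \<otimes>\<^bsub>G\<^esub> a [^]\<^bsub>G\<^esub> int (m * i)"
    define k where "k = g \<otimes>\<^bsub>G\<^esub> a [^]\<^bsub>G\<^esub> int (n * i)"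
    have hk: "h = k \<otimes>\<^bsub>G\<^esub> b" using pow_mult_b[OF g] by (simp add: h_def k_def g'_def)
    have c: "h \<in> carrier G" "k \<in> carrier G" using g g' by (simp_all add: h_def k_def)
    have "(\<Sum>k=1..m. real_of_int (top_label (T h) k)) = (\<Sum>k<m. u g' (m * i + k))"
    proof (rule sum.reindex_bij_witness[of _ Suc "\<lambda>k. k - 1"])
      fix k assume "k \<in> {1..m}"
      then show "u g' (m * i + (k - 1)) = real_of_int (top_label (T h) k)"
        using top_label_eq_top_label_1[OF T c(1), of k] g'
        by (simp add: u_def h_def a_pow_add of_nat_diff add_diff_eq)
    qed auto
    moreover have "(\<Sum>j=1..n. real_of_int (bottom_label (T h) j)) = (\<Sum>j<n. u g (n * i + j))"
    proof (rule sum.reindex_bij_witness[of _ Suc "\<lambda>k. k - 1"])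
      fix j assume "j \<in> {1..n}"
      then show "u g (n * i + (j - 1)) = real_of_int (bottom_label (T h) j)"
        using bottom_label_eq_top_label_1[OF T c(2), of j] g
        by (simp add: u_def hk) (simp add: k_def a_pow_add of_nat_diff add_diff_eq)
    qed auto
    moreover have "tile_color (T h) = tile_color (T g')"
      using tile_color_line[OF T g', of "int i"] by (simp add: h_def)
    moreover have "fst (right_label (T h)) = L (Suc i)"
      using wang_space_horizontal[OF T c(1)] g' by (simp add: L_def h_def a_pow_add add.commute)
    moreover have "fst (left_label (T h)) = L i" by (simp add: L_def h_def)
    ultimately show ?thesis
      using tileset_S0_balance[OF wang_space_tile[OF T c(1)]] by simp
  qed
  \<comment> \<open>Needed for \<open>k = m\<close>: the last side label sits \<open>m * M\<close>
    steps from the first and so equals it.\<close>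
  have "T (g' \<otimes>\<^bsub>G\<^esub> a [^]\<^bsub>G\<^esub> int (k * M)) = T g'" for k
  proof (induction k)
    case (Suc k)
    then show ?case
      using per[of "g' \<otimes>\<^bsub>G\<^esub> a [^]\<^bsub>G\<^esub> int (k * M)"] g' by (simp add: a_pow_add add.commute)
  qed (use g' in simp)
  then have "L M = L 0" using g' by (simp add: L_def del: of_nat_mult)
  then have "(\<Sum>i<M. L (Suc i) - L i) = 0" by (simp add: sum_lessThan_telescope)
  then have "?r / real m * (\<Sum>i<M. \<Sum>k<m. u g' (m * i + k)) =
      1 / real n * (\<Sum>i<M. \<Sum>j<n. u g (n * i + j))"
    by (simp add: sum_subtractf sum_distrib_left flip: tile)
  then have "?r / real m * (\<Sum>l<m * M. u g' l) = 1 / real n * (\<Sum>l<n * M. u g l)"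
    by (simp add: mult.commute[of _ M] sum_lessThan_mult del: sum_divide_distrib)
  then have "?r * (\<Sum>l<M. u g' l) = (\<Sum>l<M. u g l)"
    using m_pos n_pos g g' by (simp add: sum_periodic u_per)
  then show ?thesis by (simp add: line_sum_def u_def g'_def)
qed

lemma line_sum_iterate:
  assumes T: "T \<in> wang_space m n (tileset_S0 m n)" and g: "g \<in> carrier G"
    and per: "\<And>h. h \<in> carrier G \<Longrightarrow> T (h \<otimes>\<^bsub>G\<^esub> a [^]\<^bsub>G\<^esub> int M) = T h"
  shows "\<exists>i j. i + j = N \<and> line_sum T M g = 2 ^ i / 3 ^ j * line_sum T M (g \<otimes>\<^bsub>G\<^esub> b [^]\<^bsub>G\<^esub> N)"
proof (induction N)
  case 0
  show ?case using g by simp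
next
  case (Suc N)
  then obtain i j where ij: "i + j = N"
    and eq: "line_sum T M g = 2 ^ i / 3 ^ j * line_sum T M (g \<otimes>\<^bsub>G\<^esub> b [^]\<^bsub>G\<^esub> N)" by blast
  define h where "h = g \<otimes>\<^bsub>G\<^esub> b [^]\<^bsub>G\<^esub> Suc N"
  have "rate (tile_color (T h)) * line_sum T M h = line_sum T M (g \<otimes>\<^bsub>G\<^esub> b [^]\<^bsub>G\<^esub> N)"
    using line_sum_mult_b[OF T _ per, of "g \<otimes>\<^bsub>G\<^esub> b [^]\<^bsub>G\<^esub> N"] g by (simp add: h_def m_assoc)
  then have eq': "line_sum T M g = 2 ^ i / 3 ^ j * rate (tile_color (T h)) * line_sum T M h"
    using eq by simp
  show ?case
  proof (cases "tile_color (T h) = 1")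
    case True
    then show ?thesis using eq' ij
      by (intro exI[of _ "Suc i"] exI[of _ j]) (simp add: rate_def h_def)
  next
    case False
    then show ?thesis using eq' ij
      by (intro exI[of _ i] exI[of _ "Suc j"]) (simp add: rate_def h_def)
  qed
qed

text \<open>On color 1 the condition on three consecutive labels supplies a 1; any other tile comes
  from some \<open>x\<close> that is at least 1, which forces its label to be at least 1.\<close>

lemma Y_S0_top_pos:
  assumes "T \<in> Y_S0 m n" "g \<in> carrier G"
  shows "\<exists>i::int. top_label (T (g \<otimes>\<^bsub>G\<^esub> a [^]\<^bsub>G\<^esub> i)) 1 \<ge> 1"
proof (cases "tile_color (T g) = 1")
  case True
  then have "\<exists>i\<in>{0::int, 0 + 1, 0 + 2}. top_label (T (g \<otimes>\<^bsub>G\<^esub> a [^]\<^bsub>G\<^esub> i)) 1 = 1"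
    using assms unfolding Y_S0_def by blast
  then show ?thesis by (metis order_refl)
next
  case False
  moreover have "T g \<in> tileset_S0 m n" using assms by (auto simp: Y_S0_def dest: wang_space_tile)
  ultimately have "top_label (T g) 1 \<ge> 1" by (intro tileset_S0_top_pos[OF m_pos])
  then show ?thesis using assms(2) by (intro exI[of _ 0]) simp
qed

lemma line_sum_pos:
  assumes T: "T \<in> Y_S0 m n" and g: "g \<in> carrier G" and "M > 0"
    and per: "\<And>h. h \<in> carrier G \<Longrightarrow> T (h \<otimes>\<^bsub>G\<^esub> a [^]\<^bsub>G\<^esub> int M) = T h"
  shows "line_sum T M g > 0"
proof -
  obtain i :: int where i: "top_label (T (g \<otimes>\<^bsub>G\<^esub> a [^]\<^bsub>G\<^esub> i)) 1 \<ge> 1"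
    using Y_S0_top_pos[OF T g] by blast
  have mult: "T (g \<otimes>\<^bsub>G\<^esub> a [^]\<^bsub>G\<^esub> (r + int M * k)) = T (g \<otimes>\<^bsub>G\<^esub> a [^]\<^bsub>G\<^esub> r)" for r k
  proof (induction k rule: int_induct[where k = 0])
    case (step1 k)
    then show ?case
      using per[of "g \<otimes>\<^bsub>G\<^esub> a [^]\<^bsub>G\<^esub> (r + int M * k)"] g by (simp add: a_pow_add algebra_simps)
  next
    case (step2 k)
    then show ?case
      using per[of "g \<otimes>\<^bsub>G\<^esub> a [^]\<^bsub>G\<^esub> (r + int M * (k - 1))"] g by (simp add: a_pow_add algebra_simps)
  qed simp
  \<comment> \<open>Reducing \<open>i\<close> modulo the period moves the positive label into the
    range of the sum.\<close>
  have "T (g \<otimes>\<^bsub>G\<^esub> a [^]\<^bsub>G\<^esub> i) = T (g \<otimes>\<^bsub>G\<^esub> a [^]\<^bsub>G\<^esub> (i mod int M))"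
    using mult[of "i mod int M" "i div int M"] by simp
  with i have "top_label (T (g \<otimes>\<^bsub>G\<^esub> a [^]\<^bsub>G\<^esub> int (nat (i mod int M)))) 1 \<ge> 1"
    using \<open>M > 0\<close> by simp
  moreover have "nat (i mod int M) < M" using \<open>M > 0\<close> by (simp add: nat_less_iff)
  moreover have "top_label (T h) 1 \<ge> 0" if "h \<in> carrier G" for h
    using T that by (intro tileset_S0_top_nonneg[OF m_pos]) (auto simp: Y_S0_def dest: wang_space_tile)
  ultimately show ?thesis
    unfolding line_sum_def using g
    by (intro sum_pos2[of _ "nat (i mod int M)"]) auto
qed

lemma Y_S0_not_strongly_periodic:
  assumes T: "T \<in> Y_S0 m n"
  shows "\<not> strongly_periodic G T"
proof
  assume sp: "strongly_periodic G T"
  obtain M :: nat where "M > 0" and M: "\<And>g h. g \<in> carrier G \<Longrightarrow> h \<in> carrier G \<Longrightarrow>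
      T (g \<otimes>\<^bsub>G\<^esub> a [^]\<^bsub>G\<^esub> M \<otimes>\<^bsub>G\<^esub> inv\<^bsub>G\<^esub> g \<otimes>\<^bsub>G\<^esub> h) = T h"
    using strongly_periodic_power[OF is_group sp gen_closed(1)] by blast
  obtain N :: nat where "N > 0" and N: "\<And>g h. g \<in> carrier G \<Longrightarrow> h \<in> carrier G \<Longrightarrow>
      T (g \<otimes>\<^bsub>G\<^esub> b [^]\<^bsub>G\<^esub> N \<otimes>\<^bsub>G\<^esub> inv\<^bsub>G\<^esub> g \<otimes>\<^bsub>G\<^esub> h) = T h"
    using strongly_periodic_power[OF is_group sp gen_closed(2)] by blast
  \<comment> \<open>Taking the conjugating element equal to \<open>h\<close> turns the period into
    right multiplication by \<open>a^M\<close>.\<close>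
  have per: "T (h \<otimes>\<^bsub>G\<^esub> a [^]\<^bsub>G\<^esub> int M) = T h" if "h \<in> carrier G" for h
    using M[of h h] that by (simp add: m_assoc int_pow_int)
  have TW: "T \<in> wang_space m n (tileset_S0 m n)" using T by (simp add: Y_S0_def)
  obtain i j where ij: "i + j = N"
    and "line_sum T M \<one>\<^bsub>G\<^esub> = 2 ^ i / 3 ^ j * line_sum T M (\<one>\<^bsub>G\<^esub> \<otimes>\<^bsub>G\<^esub> b [^]\<^bsub>G\<^esub> N)"
    using line_sum_iterate[OF TW one_closed per] by blast
  \<comment> \<open>Here the period acts by left multiplication: \<open>b^N\<close> carries the line
    of the identity to the line of \<open>b^N\<close>.\<close>
  moreover have "line_sum T M (\<one>\<^bsub>G\<^esub> \<otimes>\<^bsub>G\<^esub> b [^]\<^bsub>G\<^esub> N) = line_sum T M \<one>\<^bsub>G\<^esub>"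
    using N[of "\<one>\<^bsub>G\<^esub>"] by (simp add: line_sum_def)
  ultimately have "line_sum T M \<one>\<^bsub>G\<^esub> = 2 ^ i / 3 ^ j * line_sum T M \<one>\<^bsub>G\<^esub>" by simp
  then have "2 ^ i / 3 ^ j = (1::real)"
    using line_sum_pos[OF T one_closed \<open>M > 0\<close> per] unfolding mult_cancel_right1 by simp
  then show False using pow2_div_pow3_neq_1[of i j] ij \<open>N > 0\<close> by simp
qed

section \<open>The condition on color 1 as a local rule\<close>

lemma is_SFT_Y_S0: "is_SFT G (tileset_S0 m n) (Y_S0 m n)"
proof -
  define P :: "(letter list set \<Rightarrow> (int, real \<times> nat) wang_tile) \<Rightarrow> bool" where
    "P y \<longleftrightarrow> right_label (y \<one>\<^bsub>G\<^esub>) = left_label (y (a [^]\<^bsub>G\<^esub> m)) \<and>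
      (\<forall>k\<in>{1..m}. \<forall>j\<in>{1..n}. top_label (y \<one>\<^bsub>G\<^esub>) k =
        bottom_label (y (a [^]\<^bsub>G\<^esub> (int k - int j) \<otimes>\<^bsub>G\<^esub> b)) j) \<and>
      (tile_color (y \<one>\<^bsub>G\<^esub>) = 1 \<longrightarrow>
        (\<forall>j\<in>{0..<int m}. \<exists>i\<in>{j, j + 1, j + 2}. top_label (y (a [^]\<^bsub>G\<^esub> i)) 1 = 1))" for y
  \<comment> \<open>The last tested triple starts at \<open>m - 1\<close> and therefore reaches
    \<open>m + 1\<close>.\<close>
  define W where "W = {\<one>\<^bsub>G\<^esub>, a [^]\<^bsub>G\<^esub> m} \<union>
    (\<lambda>(k, j). a [^]\<^bsub>G\<^esub> (int k - int j) \<otimes>\<^bsub>G\<^esub> b) ` ({1..m} \<times> {1..n}) \<union>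
    (\<lambda>i. a [^]\<^bsub>G\<^esub> i) ` {0..int m + 1}"
  have P_window: "P y = P z" if yz: "\<And>h. h \<in> W \<Longrightarrow> y h = z h" for y z
  proof -
    have base: "y \<one>\<^bsub>G\<^esub> = z \<one>\<^bsub>G\<^esub>" "y (a [^]\<^bsub>G\<^esub> m) = z (a [^]\<^bsub>G\<^esub> m)"
      by (auto intro!: yz simp: W_def)
    have b_eq: "y (a [^]\<^bsub>G\<^esub> (int k - int j) \<otimes>\<^bsub>G\<^esub> b) = z (a [^]\<^bsub>G\<^esub> (int k - int j) \<otimes>\<^bsub>G\<^esub> b)"
      if "k \<in> {1..m}" "j \<in> {1..n}" for k j
      using that by (intro yz) (force simp: W_def)
    have pow_eq: "y (a [^]\<^bsub>G\<^esub> i) = z (a [^]\<^bsub>G\<^esub> i)" if "i \<in> {0..int m + 1}" for i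
      using that by (intro yz) (auto simp: W_def)
    have vertical: "(\<forall>k\<in>{1..m}. \<forall>j\<in>{1..n}. top_label (y \<one>\<^bsub>G\<^esub>) k =
          bottom_label (y (a [^]\<^bsub>G\<^esub> (int k - int j) \<otimes>\<^bsub>G\<^esub> b)) j) \<longleftrightarrow>
        (\<forall>k\<in>{1..m}. \<forall>j\<in>{1..n}. top_label (z \<one>\<^bsub>G\<^esub>) k =
          bottom_label (z (a [^]\<^bsub>G\<^esub> (int k - int j) \<otimes>\<^bsub>G\<^esub> b)) j)"
      by (intro ball_cong refl) (simp_all only: base b_eq)
    have ones: "(\<forall>j\<in>{0..<int m}. \<exists>i\<in>{j, j + 1, j + 2}. top_label (y (a [^]\<^bsub>G\<^esub> i)) 1 = 1) \<longleftrightarrow>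
        (\<forall>j\<in>{0..<int m}. \<exists>i\<in>{j, j + 1, j + 2}. top_label (z (a [^]\<^bsub>G\<^esub> i)) 1 = 1)"
      by (intro ball_cong bex_cong refl) (auto simp: pow_eq)
    show ?thesis unfolding P_def vertical ones by (simp only: base)
  qed
  have "T \<in> Y_S0 m n \<longleftrightarrow> (\<forall>g\<in>carrier G. P (\<lambda>h. T (g \<otimes>\<^bsub>G\<^esub> h)))"
    if T: "T \<in> carrier G \<rightarrow>\<^sub>E tileset_S0 m n" for T
  proof
    assume Y: "T \<in> Y_S0 m n"
    then have "T \<in> wang_space m n (tileset_S0 m n)" by (simp add: Y_S0_def)
    with Y show "\<forall>g\<in>carrier G. P (\<lambda>h. T (g \<otimes>\<^bsub>G\<^esub> h))"
      by (simp add: P_def Y_S0_def wang_space_def m_assoc)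
  next
    assume P: "\<forall>g\<in>carrier G. P (\<lambda>h. T (g \<otimes>\<^bsub>G\<^esub> h))"
    then have W: "T \<in> wang_space m n (tileset_S0 m n)"
      using T by (simp add: P_def wang_space_def m_assoc)
    have "\<exists>i\<in>{j, j + 1, j + 2}. top_label (T (g \<otimes>\<^bsub>G\<^esub> a [^]\<^bsub>G\<^esub> i)) 1 = 1"
      if g: "g \<in> carrier G" "tile_color (T g) = 1" for g and j :: int
    proof -
      \<comment> \<open>Moving the base point by a multiple of \<open>m\<close> keeps the color and
        turns the start \<open>j\<close> into its residue modulo \<open>m\<close>, where
        \<open>P\<close> applies.\<close>
      let ?g = "g \<otimes>\<^bsub>G\<^esub> a [^]\<^bsub>G\<^esub> (int m * (j div int m))"
      have "tile_color (T ?g) = 1" using tile_color_line[OF W g(1)] g(2) by simp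
      moreover have "P (\<lambda>h. T (?g \<otimes>\<^bsub>G\<^esub> h))" using P g by simp
      moreover have "j mod int m \<in> {0..<int m}" using m_pos by simp
      ultimately have "\<exists>i\<in>{j mod int m, j mod int m + 1, j mod int m + 2}.
          top_label (T (?g \<otimes>\<^bsub>G\<^esub> a [^]\<^bsub>G\<^esub> i)) 1 = 1"
        using g(1) unfolding P_def by simp
      then show ?thesis using g(1) by (simp add: a_pow_add flip: add.assoc)
    qed
    with W show "T \<in> Y_S0 m n" by (simp add: Y_S0_def)
  qed
  moreover have "Y_S0 m n \<subseteq> carrier G \<rightarrow>\<^sub>E tileset_S0 m n"
    by (auto simp only: Y_S0_def wang_space_def)
  ultimately have eq: "Y_S0 m n =
      {T \<in> carrier G \<rightarrow>\<^sub>E tileset_S0 m n. \<forall>g\<in>carrier G. P (\<lambda>h. T (g \<otimes>\<^bsub>G\<^esub> h))}"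
    by blast
  have W: "finite W" "W \<subseteq> carrier G" by (auto simp: W_def)
  show ?thesis
    unfolding eq by (rule is_SFT_local_rule[OF is_group finite_tileset_S0[OF m_pos n_pos] W P_window])
qed

end

section \<open>A configuration\<close>

text \<open>
  On \<open>[1/3, 2)\<close> the two maps glue to a bijection, with branches \<open>[1/3, 1) \<rightarrow> [2/3, 2)\<close> and
  \<open>[1, 2) \<rightarrow> [1/3, 2/3)\<close>.
\<close>
lemma two_sided_orbit_exists:
  "\<exists>x :: int \<Rightarrow> real. \<forall>h. 1/3 \<le> x h \<and> x h < 2 \<and>
    x h = (if x (h + 1) < 1 then 2 * x (h + 1) else x (h + 1) / 3)"
proof -
  define f where "f y = (if y < 1 then 2 * y else y / 3)" for y :: real
  \<comment> \<open>A right inverse of \<open>f\<close>: the threshold \<open>2/3\<close> separates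
    the images of the two branches.\<close>
  define f' where "f' y = (if y < 2/3 then 3 * y else y / 2)" for y :: real
  let ?I = "{1/3..<2::real}"
  have fI: "f y \<in> ?I" and f'I: "f' y \<in> ?I" and ff': "f (f' y) = y" if "y \<in> ?I" for y
    using that by (auto simp: f_def f'_def)
  have fpow: "(f ^^ k) 1 \<in> ?I" for k
    by (induction k) (simp_all del: atLeastLessThan_iff add: fI, simp)
  have f'pow: "(f' ^^ k) 1 \<in> ?I" for k
    by (induction k) (simp_all del: atLeastLessThan_iff add: f'I, simp)
  \<comment> \<open>The orbit passes through 1 at level 0; \<open>f'\<close> goes up from there and
    \<open>f\<close> goes down.\<close>
  define x where "x h = (if h \<ge> 0 then (f' ^^ nat h) 1 else (f ^^ nat (- h)) 1)" for h :: int
  have "x h \<in> ?I" for h using fpow f'pow by (simp add: x_def)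
  moreover have "x h = f (x (h + 1))" for h
  proof (cases "h \<ge> 0")
    case True
    then show ?thesis using ff'[OF f'pow] by (simp add: x_def nat_add_distrib)
  next
    case False
    then have "nat (- h) = Suc (nat (- h - 1))" by simp
    \<comment> \<open>\<open>h = -1\<close> is separate because \<open>h + 1\<close> then falls
      under the nonnegative branch of \<open>x\<close>.\<close>
    then show ?thesis using False by (cases "h = -1") (auto simp: x_def)
  qed
  ultimately show ?thesis unfolding f_def atLeastLessThan_iff by blast
qed

text \<open>Each step is 0 or 1, and three zero steps would give
  \<open>F (j + 3) = F j\<close>.\<close>

lemma unit_step_exists:
  fixes F :: "int \<Rightarrow> int"
  assumes le: "\<And>i. F (i + 1) - F i \<le> 1" and ge: "\<And>i. F (i + 1) - F i \<ge> 0" and "F (j + 3) > F j"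
  shows "\<exists>i\<in>{j, j + 1, j + 2}. F (i + 1) - F i = 1"
proof (rule ccontr)
  assume neg: "\<not> ?thesis"
  have "F (i + 1) = F i" if "i \<in> {j, j + 1, j + 2}" for i
  proof -
    have "F (i + 1) - F i \<noteq> 1" using neg that by blast
    then show ?thesis using le[of i] ge[of i] by linarith
  qed
  from this[of j] this[of "j + 1"] this[of "j + 2"] show False using assms(3) by (simp add: add.assoc)
qed

context baumslag_solitar
begin

lemma Y_S0_nonempty: "Y_S0 m n \<noteq> {}"
proof -
  obtain x :: "int \<Rightarrow> real" where x: "\<And>h. 1/3 \<le> x h" "\<And>h. x h < 2"
    and x_step: "\<And>h. x h = (if x (h + 1) < 1 then 2 * x (h + 1) else x (h + 1) / 3)"
    using two_sided_orbit_exists by metis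
  define c where "c h = (if x h < 1 then 1 else 2 :: nat)" for h
  define q where "q h = (if x h < 1 then 2 else 1/3 :: rat)" for h
  \<comment> \<open>The bottom of a tile at level \<open>h + 1\<close> encodes \<open>q x\<close>,
    which has to be the number encoded by the tops at level \<open>h\<close>.\<close>
  have x_q: "x h = of_rat (q (h + 1)) * x (h + 1)" for h
    by (subst x_step) (simp add: q_def of_rat_divide)
  define tile where "tile g h = Wang_Tile (map (tile_top m n g (x h)) [1..<m + 1])
    (tile_left m n (q h) g (x h), c h) (tile_right m n (q h) g (x h), c h)
    (map (tile_bottom m n (q h) g (x h)) [1..<n + 1])" for g h
  define T where "T = (\<lambda>g\<in>carrier G. tile g (height g))"
  have T: "T g = tile g (height g)" if "g \<in> carrier G" for g using that by (simp add: T_def)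
  have top: "top_label (T g) k = tile_top m n g (x (height g)) k"
    if "g \<in> carrier G" "k \<in> {1..m}" for g k
    unfolding T[OF that(1)] tile_def by (rule top_label_Wang_Tile[OF that(2)])
  have bottom: "bottom_label (T g) k = tile_bottom m n (q (height g)) g (x (height g)) k"
    if "g \<in> carrier G" "k \<in> {1..n}" for g k
    unfolding T[OF that(1)] tile_def by (rule bottom_label_Wang_Tile[OF that(2)])
  have lam_pow: "real m * lam m n (g \<otimes>\<^bsub>G\<^esub> a [^]\<^bsub>G\<^esub> (i::int)) = real m * lam m n g + of_int i"
    if "g \<in> carrier G" for g i
    using that m_pos by (simp add: lam_mult_a_pow distrib_left)
  have "T \<in> carrier G \<rightarrow>\<^sub>E tileset_S0 m n"
  proof
    fix g assume g: "g \<in> carrier G"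
    let ?h = "height g"
    have "Wang_Tile (map (tile_top m n g (x ?h)) [1..<m + 1]) (tile_left m n (q ?h) g (x ?h))
        (tile_right m n (q ?h) g (x ?h)) (map (tile_bottom m n (q ?h) g (x ?h)) [1..<n + 1])
      \<in> tileset m n (q ?h) (if x ?h < 1 then {0..1} else {1..2})"
      unfolding tileset_def using g x[of ?h] by (intro CollectI exI[of _ g] exI[of _ "x ?h"]) auto
    then show "T g \<in> tileset_S0 m n"
      unfolding T[OF g] tile_def tileset_S0_def c_def q_def by (auto split: if_splits)
  qed (simp add: T_def)
  moreover have "right_label (T g) = left_label (T (g \<otimes>\<^bsub>G\<^esub> a [^]\<^bsub>G\<^esub> m))" if g: "g \<in> carrier G" for g
  proof -
    let ?g = "g \<otimes>\<^bsub>G\<^esub> a [^]\<^bsub>G\<^esub> int m"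
    have "lam m n ?g = lam m n g + 1" using g m_pos by (simp add: lam_mult_a_pow)
    then have "tile_right m n p g y = tile_left m n p ?g y" for p y
      by (simp add: tile_right_def tile_left_def distrib_left)
    then have "right_label (T g) = left_label (T ?g)"
      using g by (simp add: T tile_def height_mult_a_pow)
    then show ?thesis by (simp add: int_pow_int)
  qed
  moreover have "top_label (T g) k =
      bottom_label (T (g \<otimes>\<^bsub>G\<^esub> a [^]\<^bsub>G\<^esub> (int k - int j) \<otimes>\<^bsub>G\<^esub> b)) j"
    if g: "g \<in> carrier G" and k: "k \<in> {1..m}" and j: "j \<in> {1..n}" for g k j
  proof -
    let ?g = "g \<otimes>\<^bsub>G\<^esub> a [^]\<^bsub>G\<^esub> (int k - int j)"
    have "height (?g \<otimes>\<^bsub>G\<^esub> b) = height g + 1"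
      using g by (simp add: height_mult height_a_pow height_b)
    \<comment> \<open>With this, the floors of the top label and of the bottom label have equal
      arguments.\<close>
    moreover have "real n * lam m n (?g \<otimes>\<^bsub>G\<^esub> b) = real m * lam m n g + real k - real j"
      using g lam_mult_b[of ?g] by (simp add: lam_pow)
    ultimately show ?thesis
      using g k j by (simp add: top bottom tile_top_def tile_bottom_def mult.assoc flip: x_q)
  qed
  moreover have "\<exists>i\<in>{j, j + 1, j + 2}. top_label (T (g \<otimes>\<^bsub>G\<^esub> a [^]\<^bsub>G\<^esub> i)) 1 = 1"
    if g: "g \<in> carrier G" and color: "tile_color (T g) = 1" for g and j :: int
  proof -
    let ?x = "x (height g)"
    let ?F = "\<lambda>i. \<lfloor>(real m * lam m n g + of_int i) * ?x\<rfloor>"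
    have "?x < 1" using color g by (simp add: T tile_def tile_color_def c_def split: if_splits)
    have t: "top_label (T (g \<otimes>\<^bsub>G\<^esub> a [^]\<^bsub>G\<^esub> i)) 1 = ?F (i + 1) - ?F i" for i :: int
      using g m_pos by (simp add: top height_mult_a_pow tile_top_def lam_pow add.assoc)
    have le: "?F (i + 1) - ?F i \<le> 1" for i
    proof -
      have "(real m * lam m n g + of_int (i + 1)) * ?x = (real m * lam m n g + of_int i) * ?x + ?x"
        by (simp add: algebra_simps)
      then show ?thesis using \<open>?x < 1\<close> by linarith
    qed
    have ge: "?F (i + 1) - ?F i \<ge> 0" for i
      using x(1)[of "height g"] by (simp add: floor_mono mult_right_mono)
    \<comment> \<open>Three steps add \<open>3 x\<close>, which is at least 1, so the floor
      increases.\<close>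
    have "(real m * lam m n g + of_int (j + 3)) * ?x = (real m * lam m n g + of_int j) * ?x + 3 * ?x"
      by (simp add: algebra_simps)
    then have "?F (j + 3) \<ge> ?F j + 1" using x(1)[of "height g"] by linarith
    then have "\<exists>i\<in>{j, j + 1, j + 2}. ?F (i + 1) - ?F i = 1"
      by (intro unit_step_exists[where F = ?F] le ge) simp
    then show ?thesis unfolding t .
  qed
  ultimately have "T \<in> Y_S0 m n" by (simp add: Y_S0_def wang_space_def)
  then show ?thesis by blast
qed

end

theorem corollary2p9:
  fixes m n :: nat
  assumes "m \<ge> 1" and "n \<ge> 1"
  shows "Y_S0 m n \<noteq> {} \<and> weakly_aperiodic_SFT (BS m n) (tileset_S0 m n) (Y_S0 m n)"
proof -
  interpret baumslag_solitar m n using assms by unfold_locales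
  show ?thesis
    using is_SFT_Y_S0 Y_S0_nonempty Y_S0_not_strongly_periodic
    by (simp add: weakly_aperiodic_SFT_def)
qed

end
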